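(* Let $\mathrm{P}\in\{\mathrm{cICK},\mathrm{cICKT},\mathrm{cICKS4},\mathrm{cICKS5}\}$ and let $\sigma$ be a sequent. If $\sigma$ has a cyclic proof in $\mathrm{P}$, then $\sigma$ is valid over the class of frames associated with $\mathrm{P}$ (all epistemic frames for $\mathrm{cICK}$, reflexive frames for $\mathrm{cICKT}$, S4 frames for $\mathrm{cICKS4}$, S5 frames for $\mathrm{cICKS5}$).
   Context: Formulae over a finite non-empty set $\mathsf{A}$ of agents and atoms $\mathrm{Prop}$: $\varphi ::= \bot \mid p \mid \varphi\wedge\varphi\mid\varphi\vee\varphi\mid\varphi\to\varphi\mid K_a\varphi\mid C\varphi$; $\neg\varphi:=\varphi\to\bot$. Semantics: an epistemic frame $(\mathcal{W},\leq,\{R_a\})$ has $\mathcal{W}\neq\emptyset$, $\leq$ a partial order, $R_a\subseteq\mathcal{W}^2$ with triangle confluence ($w\leq v$, $vR_au$ imply $wR_au$); reflexive/S4/S5 frames have each $R_a$ reflexive / reflexive and transitive / an equivalence relation. Models add a $\leq$-monotone valuation; $w\models\varphi\to\psi$ iff for all $v\geq w$, $v\models\varphi$ implies $v\models\psi$; $w\models K_a\varphi$ iff all $R_a$-successors satisfy $\varphi$; $w\models C\varphi$ iff all $R^*$-successors satisfy $\varphi$ ($R^*$ reflexive–transitive closure of $\bigcup_aR_a$); atoms, $\bot,\wedge,\vee$ as usual. Sequents: an annotated formula is $\varphi^x$ with $x\in\{\mathsf{u},\mathsf{f}\}$ (unfocused / in focus). For a set $\Gamma$ of annotated formulae, $\Gamma^-=\{\varphi:\varphi^x\in\Gamma\}$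 and $K_a\Gamma=\{(K_a\psi)^x:\psi^x\in\Gamma\}$. A sequent $\Gamma\Rightarrow\Delta$ consists of finite sets of annotated formulae such that all formulae in $\Gamma$ are unfocused, at most one formula of $\Delta$ is in focus, and a focused formula has the form $C\psi$ or $K_aC\psi$. It is valid over a class if $\bigwedge\Gamma^-\to\bigvee\Delta^-$ is (empty conjunction $\bot\to\bot$, empty disjunction $\bot$). Rules (premises $\Rightarrow$ conclusion; $\Gamma,\Delta,\Pi,\Sigma$ finite, possibly empty; $x\in\{\mathsf{u},\mathsf{f}\}$; premises and conclusion must be sequents): axioms id: $\Gamma,\varphi^{\mathsf{u}}\Rightarrow\varphi^x,\Delta$ and $\bot$: $\Gamma,\bot^{\mathsf{u}}\Rightarrow\Delta$; $\wedge$L: $\Gamma,\varphi^{\mathsf{u}},\psi^{\mathsf{u}}\Rightarrow\Delta$ / $\Gamma,(\varphi\wedge\psi)^{\mathsf{u}}\Rightarrow\Delta$; $\wedge$R: $\Gamma\Rightarrow\varphi^{\mathsf{u}},\Delta$ and $\Gamma\Rightarrow\psi^{\mathsf{u}},\Delta$ / $\Gamma\Rightarrow(\varphi\wedge\psi)^{\mathsf{u}},\Delta$; $\vee$L: $\Gamma,\varphi^{\mathsf{u}}\Rightarrow\Delta$ and $\Gamma,\psi^{\mathsf{u}}\Rightarrow\Delta$ / $\Gamma,(\varphi\vee\psi)^{\mathsf{u}}\Rightarrow\Delta$; $\vee$R: $\Gamma\Rightarrow\varphi^{\mathsf{u}},\psi^{\mathsf{u}},\Delta$ / $\Gamma\Rightarrow(\varphi\vee\psi)^{\mathsf{u}},\Delta$;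 $\to$L: $\Gamma\Rightarrow\varphi^{\mathsf{u}},\Delta$ and $\Gamma,\psi^{\mathsf{u}}\Rightarrow\Delta$ / $\Gamma,(\varphi\to\psi)^{\mathsf{u}}\Rightarrow\Delta$; $\to$R: $\Gamma,\varphi^{\mathsf{u}}\Rightarrow\psi^{\mathsf{u}}$ / $\Gamma\Rightarrow(\varphi\to\psi)^{\mathsf{u}},\Delta$; u: $\Gamma\Rightarrow\varphi^{\mathsf{u}},\Delta$ / $\Gamma\Rightarrow\varphi^{\mathsf{f}},\Delta$; f: $\Gamma\Rightarrow\varphi^{\mathsf{f}},\Delta$ / $\Gamma\Rightarrow\varphi^{\mathsf{u}},\Delta$; $\mathsf{K}_a$: $\Gamma\Rightarrow\varphi^x$ / $\Pi,K_a\Gamma\Rightarrow(K_a\varphi)^x,\Sigma$; $\mathsf{T}_a$: $\Gamma,\varphi^{\mathsf{u}}\Rightarrow\Delta$ / $\Gamma,(K_a\varphi)^{\mathsf{u}}\Rightarrow\Delta$; $\mathsf{S4}_a$: $K_a\Gamma\Rightarrow\varphi^x$ / $\Pi,K_a\Gamma\Rightarrow(K_a\varphi)^x,\Sigma$; $\mathsf{S5}_a$: $K_a\Gamma\Rightarrow\varphi^x,K_a\Delta$ / $\Pi,K_a\Gamma\Rightarrow(K_a\varphi)^x,K_a\Delta,\Sigma$; $\mathsf{K}_a{\to}$: $\Gamma,(K_a\varphi)^{\mathsf{u}}\Rightarrow\psi^{\mathsf{u}},\Delta$ / $\Gamma\Rightarrow(K_a\varphi\to\psi)^{\mathsf{u}},\Delta$;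 CL: $\Gamma,\varphi^{\mathsf{u}},\{(K_aC\varphi)^{\mathsf{u}}\}_{a\in\mathsf{A}}\Rightarrow\Delta$ / $\Gamma,(C\varphi)^{\mathsf{u}}\Rightarrow\Delta$; CR: $\Gamma\Rightarrow\varphi^{\mathsf{u}},\Delta$ and, for each $a\in\mathsf{A}$, $\Gamma\Rightarrow(K_aC\varphi)^x,\Delta$ / $\Gamma\Rightarrow(C\varphi)^x,\Delta$ (the distinguished $C\varphi$ is the principal formula); cut: $\Gamma,\varphi^{\mathsf{u}}\Rightarrow\Delta$ and $\Gamma\Rightarrow\varphi^{\mathsf{u}},\Delta$ / $\Gamma\Rightarrow\Delta$. Calculi: $\mathrm{cICK}$ = id, $\bot$, $\wedge$L/R, $\vee$L/R, $\to$L/R, u, f, $\mathsf{K}_a$ ($a\in\mathsf{A}$), CL, CR; $\mathrm{cICKT}$ = $\mathrm{cICK}$ plus $\mathsf{T}_a$; $\mathrm{cICKS4}$ = $\mathrm{cICKT}$ with $\mathsf{K}_a$ replaced by $\mathsf{S4}_a$; $\mathrm{cICKS5}$ = $\mathrm{cICKS4}$ with $\mathsf{S4}_a$ replaced by $\mathsf{S5}_a$, plus $\mathsf{K}_a{\to}$ and cut. A cyclic pre-proof of $\sigma$ is a finite tree labelled by sequents, root $\sigma$, each inner node with its children forming a rule instance. A path is successful if every sequent on it has a formula in focus and it passes through at least one CR instance whose principal formula is in focus. A repetition is a pair $(u,v)$ of distinct nodes with $v$ a descendant of $u$ and both labelled by the same sequent; it is successful if the path from $u$ to $v$ is. A cyclic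 proof is a cyclic pre-proof in which every leaf is an axiom instance (id or $\bot$) or there is a node $c$ with $(c,\text{leaf})$ a successful repetition. *)

theory Defs
  imports Main "HOL-Library.Sublist"
begin

section \<open>Formulae and semantics\<close>

text \<open>The agents are the elements of a type \<open>'a\<close>, which the main theorem takes to be of class
  \<open>finite\<close>; like every type it is non-empty. The atoms are the elements of \<open>'p\<close>.\<close>

datatype ('a, 'p) fm =
    Bot ("\<bottom>\<^sub>f")
  | Atom 'p
  | Conj "('a, 'p) fm" "('a, 'p) fm" (infixr "\<and>\<^sub>f" 58)
  | Disj "('a, 'p) fm" "('a, 'p) fm" (infixr "\<or>\<^sub>f" 57)
  | Imp "('a, 'p) fm" "('a, 'p) fm" (infixr "\<rightarrow>\<^sub>f" 56)
  | K 'a "('a, 'p) fm"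
  | C "('a, 'p) fm"

record ('w, 'a) frame =
  worlds :: "'w set"
  le :: "'w rel"
  acc :: "'a \<Rightarrow> 'w rel"

definition epistemic_frame :: "('w, 'a) frame \<Rightarrow> bool" where
  "epistemic_frame F \<longleftrightarrow>
     worlds F \<noteq> {} \<and>
     partial_order_on (worlds F) (le F) \<and>
     (\<forall>a. acc F a \<subseteq> worlds F \<times> worlds F) \<and>
     (\<forall>a w v u. (w, v) \<in> le F \<longrightarrow> (v, u) \<in> acc F a \<longrightarrow> (w, u) \<in> acc F a)"

definition reflexive_frame :: "('w, 'a) frame \<Rightarrow> bool" where
  "reflexive_frame F \<longleftrightarrow> epistemic_frame F \<and> (\<forall>a. refl_on (worlds F) (acc F a))"

definition S4_frame :: "('w, 'a) frame \<Rightarrow> bool" where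
  "S4_frame F \<longleftrightarrow> epistemic_frame F \<and> (\<forall>a. refl_on (worlds F) (acc F a) \<and> trans (acc F a))"

definition S5_frame :: "('w, 'a) frame \<Rightarrow> bool" where
  "S5_frame F \<longleftrightarrow> epistemic_frame F \<and> (\<forall>a. equiv (worlds F) (acc F a))"

definition acc_star :: "('w, 'a) frame \<Rightarrow> 'w rel" where
  "acc_star F = (\<Union>a. acc F a)\<^sup>*"

definition monotone_valuation :: "('w, 'a) frame \<Rightarrow> ('w \<Rightarrow> 'p set) \<Rightarrow> bool" where
  "monotone_valuation F V \<longleftrightarrow> (\<forall>w v. (w, v) \<in> le F \<longrightarrow> V w \<subseteq> V v)"

primrec sat :: "('w, 'a) frame \<Rightarrow> ('w \<Rightarrow> 'p set) \<Rightarrow> 'w \<Rightarrow> ('a, 'p) fm \<Rightarrow> bool" where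
  "sat F V w \<bottom>\<^sub>f \<longleftrightarrow> False"
| "sat F V w (Atom p) \<longleftrightarrow> p \<in> V w"
| "sat F V w (\<phi> \<and>\<^sub>f \<psi>) \<longleftrightarrow> sat F V w \<phi> \<and> sat F V w \<psi>"
| "sat F V w (\<phi> \<or>\<^sub>f \<psi>) \<longleftrightarrow> sat F V w \<phi> \<or> sat F V w \<psi>"
| "sat F V w (\<phi> \<rightarrow>\<^sub>f \<psi>) \<longleftrightarrow> (\<forall>v. (w, v) \<in> le F \<longrightarrow> sat F V v \<phi> \<longrightarrow> sat F V v \<psi>)"
| "sat F V w (K a \<phi>) \<longleftrightarrow> (\<forall>v. (w, v) \<in> acc F a \<longrightarrow> sat F V v \<phi>)"
| "sat F V w (C \<phi>) \<longleftrightarrow> (\<forall>v. (w, v) \<in> acc_star F \<longrightarrow> sat F V v \<phi>)"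

definition valid_over :: "('w, 'a) frame set \<Rightarrow> ('a, 'p) fm \<Rightarrow> bool" where
  "valid_over \<F> \<phi> \<longleftrightarrow>
     (\<forall>F\<in>\<F>. \<forall>V. monotone_valuation F V \<longrightarrow> (\<forall>w\<in>worlds F. sat F V w \<phi>))"

section \<open>Sequents\<close>

datatype annot = Unf | Foc

type_synonym ('a, 'p) afm = "('a, 'p) fm \<times> annot"

datatype ('a, 'p) sequent =
  Sequent (ante: "('a, 'p) afm set") (succd: "('a, 'p) afm set") (infix "\<turnstile>" 50)

definition is_sequent :: "('a, 'p) sequent \<Rightarrow> bool" where
  "is_sequent \<sigma> \<longleftrightarrow>
     finite (ante \<sigma>) \<and> finite (succd \<sigma>) \<and>
     (\<forall>(\<phi>, x)\<in>ante \<sigma>. x = Unf) \<and>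
     (\<forall>\<phi> \<psi>. (\<phi>, Foc) \<in> succd \<sigma> \<longrightarrow> (\<psi>, Foc) \<in> succd \<sigma> \<longrightarrow> \<phi> = \<psi>) \<and>
     (\<forall>\<phi>. (\<phi>, Foc) \<in> succd \<sigma> \<longrightarrow> (\<exists>\<psi>. \<phi> = C \<psi> \<or> (\<exists>a. \<phi> = K a (C \<psi>))))"

definition has_focus :: "('a, 'p) sequent \<Rightarrow> bool" where
  "has_focus \<sigma> \<longleftrightarrow> (\<exists>\<phi>. (\<phi>, Foc) \<in> succd \<sigma>)"

definition erase :: "('a, 'p) afm set \<Rightarrow> ('a, 'p) fm set" where
  "erase \<Gamma> = {\<phi>. \<exists>x. (\<phi>, x) \<in> \<Gamma>}"

definition K_set :: "'a \<Rightarrow> ('a, 'p) afm set \<Rightarrow> ('a, 'p) afm set" where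
  "K_set a \<Gamma> = {(K a \<psi>, x) | \<psi> x. (\<psi>, x) \<in> \<Gamma>}"

fun conj_list :: "('a, 'p) fm list \<Rightarrow> ('a, 'p) fm" where
  "conj_list [] = \<bottom>\<^sub>f \<rightarrow>\<^sub>f \<bottom>\<^sub>f"
| "conj_list [\<phi>] = \<phi>"
| "conj_list (\<phi> # \<psi> # \<chi>s) = \<phi> \<and>\<^sub>f conj_list (\<psi> # \<chi>s)"

fun disj_list :: "('a, 'p) fm list \<Rightarrow> ('a, 'p) fm" where
  "disj_list [] = \<bottom>\<^sub>f"
| "disj_list [\<phi>] = \<phi>"
| "disj_list (\<phi> # \<psi> # \<chi>s) = \<phi> \<or>\<^sub>f disj_list (\<psi> # \<chi>s)"

text \<open>An arbitrary repetition-free enumeration of a finite set. It fixes the order of the big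
  conjunctions and disjunctions, which is immaterial up to logical equivalence.\<close>

definition enum_list :: "'b set \<Rightarrow> 'b list" where
  "enum_list S = (SOME xs. set xs = S \<and> distinct xs)"

definition sequent_fm :: "('a, 'p) sequent \<Rightarrow> ('a, 'p) fm" where
  "sequent_fm \<sigma> =
     conj_list (enum_list (erase (ante \<sigma>))) \<rightarrow>\<^sub>f disj_list (enum_list (erase (succd \<sigma>)))"

definition valid_sequent_over :: "('w, 'a) frame set \<Rightarrow> ('a, 'p) sequent \<Rightarrow> bool" where
  "valid_sequent_over \<F> \<sigma> \<longleftrightarrow> valid_over \<F> (sequent_fm \<sigma>)"

section \<open>Rules and calculi\<close>

datatype 'a rule_name =
    AxId | AxBot | AndL | AndR | OrL | OrR | ImpL | ImpR | RuleU | RuleF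
  | RuleK 'a | RuleT 'a | RuleS4 'a | RuleS5 'a | RuleKImp 'a
  | RuleCL | RuleCR annot | Cut

text \<open>\<open>rule_inst r ps \<sigma>\<close>: the premises \<open>ps\<close> (in the displayed order) and the conclusion \<open>\<sigma>\<close> form
  an instance of \<open>r\<close>. The proviso that premises and conclusion are sequents is not part of this
  relation; it is enforced in \<open>pre_proof\<close>, where every node label is required to be a
  sequent. The argument of \<open>RuleCR\<close> is the annotation of the principal formula; the list \<open>as\<close> is
  any enumeration of the agents. Contexts may contain the displayed formulae.\<close>

inductive rule_inst ::
  "'a rule_name \<Rightarrow> ('a, 'p) sequent list \<Rightarrow> ('a, 'p) sequent \<Rightarrow> bool" where
  "rule_inst AxId [] (insert (\<phi>, Unf) \<Gamma> \<turnstile> insert (\<phi>, x) \<Delta>)"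
| "rule_inst AxBot [] (insert (\<bottom>\<^sub>f, Unf) \<Gamma> \<turnstile> \<Delta>)"
| "rule_inst AndL
     [insert (\<phi>, Unf) (insert (\<psi>, Unf) \<Gamma>) \<turnstile> \<Delta>]
     (insert (\<phi> \<and>\<^sub>f \<psi>, Unf) \<Gamma> \<turnstile> \<Delta>)"
| "rule_inst AndR
     [\<Gamma> \<turnstile> insert (\<phi>, Unf) \<Delta>, \<Gamma> \<turnstile> insert (\<psi>, Unf) \<Delta>]
     (\<Gamma> \<turnstile> insert (\<phi> \<and>\<^sub>f \<psi>, Unf) \<Delta>)"
| "rule_inst OrL
     [insert (\<phi>, Unf) \<Gamma> \<turnstile> \<Delta>, insert (\<psi>, Unf) \<Gamma> \<turnstile> \<Delta>]
     (insert (\<phi> \<or>\<^sub>f \<psi>, Unf) \<Gamma> \<turnstile> \<Delta>)"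
| "rule_inst OrR
     [\<Gamma> \<turnstile> insert (\<phi>, Unf) (insert (\<psi>, Unf) \<Delta>)]
     (\<Gamma> \<turnstile> insert (\<phi> \<or>\<^sub>f \<psi>, Unf) \<Delta>)"
| "rule_inst ImpL
     [\<Gamma> \<turnstile> insert (\<phi>, Unf) \<Delta>, insert (\<psi>, Unf) \<Gamma> \<turnstile> \<Delta>]
     (insert (\<phi> \<rightarrow>\<^sub>f \<psi>, Unf) \<Gamma> \<turnstile> \<Delta>)"
| "rule_inst ImpR
     [insert (\<phi>, Unf) \<Gamma> \<turnstile> {(\<psi>, Unf)}]
     (\<Gamma> \<turnstile> insert (\<phi> \<rightarrow>\<^sub>f \<psi>, Unf) \<Delta>)"
| "rule_inst RuleU
     [\<Gamma> \<turnstile> insert (\<phi>, Unf) \<Delta>]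
     (\<Gamma> \<turnstile> insert (\<phi>, Foc) \<Delta>)"
| "rule_inst RuleF
     [\<Gamma> \<turnstile> insert (\<phi>, Foc) \<Delta>]
     (\<Gamma> \<turnstile> insert (\<phi>, Unf) \<Delta>)"
| "rule_inst (RuleK a)
     [\<Gamma> \<turnstile> {(\<phi>, x)}]
     (\<Pi> \<union> K_set a \<Gamma> \<turnstile> insert (K a \<phi>, x) \<Sigma>)"
| "rule_inst (RuleT a)
     [insert (\<phi>, Unf) \<Gamma> \<turnstile> \<Delta>]
     (insert (K a \<phi>, Unf) \<Gamma> \<turnstile> \<Delta>)"
| "rule_inst (RuleS4 a)
     [K_set a \<Gamma> \<turnstile> {(\<phi>, x)}]
     (\<Pi> \<union> K_set a \<Gamma> \<turnstile> insert (K a \<phi>, x) \<Sigma>)"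
| "rule_inst (RuleS5 a)
     [K_set a \<Gamma> \<turnstile> insert (\<phi>, x) (K_set a \<Delta>)]
     (\<Pi> \<union> K_set a \<Gamma> \<turnstile> insert (K a \<phi>, x) (K_set a \<Delta> \<union> \<Sigma>))"
| "rule_inst (RuleKImp a)
     [insert (K a \<phi>, Unf) \<Gamma> \<turnstile> insert (\<psi>, Unf) \<Delta>]
     (\<Gamma> \<turnstile> insert (K a \<phi> \<rightarrow>\<^sub>f \<psi>, Unf) \<Delta>)"
| "rule_inst RuleCL
     [insert (\<phi>, Unf) (range (\<lambda>a. (K a (C \<phi>), Unf)) \<union> \<Gamma>) \<turnstile> \<Delta>]
     (insert (C \<phi>, Unf) \<Gamma> \<turnstile> \<Delta>)"
| "set as = UNIV \<Longrightarrow> distinct as \<Longrightarrow>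
   rule_inst (RuleCR x)
     ((\<Gamma> \<turnstile> insert (\<phi>, Unf) \<Delta>) # map (\<lambda>a. \<Gamma> \<turnstile> insert (K a (C \<phi>), x) \<Delta>) as)
     (\<Gamma> \<turnstile> insert (C \<phi>, x) \<Delta>)"
| "rule_inst Cut
     [insert (\<phi>, Unf) \<Gamma> \<turnstile> \<Delta>, \<Gamma> \<turnstile> insert (\<phi>, Unf) \<Delta>]
     (\<Gamma> \<turnstile> \<Delta>)"

datatype calculus = cICK | cICKT | cICKS4 | cICKS5

definition base_rules :: "'a rule_name set" where
  "base_rules = {AxId, AxBot, AndL, AndR, OrL, OrR, ImpL, ImpR, RuleU, RuleF, RuleCL}
     \<union> range RuleCR"

fun rules :: "calculus \<Rightarrow> 'a rule_name set" where
  "rules cICK = base_rules \<union> range RuleK"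
| "rules cICKT = base_rules \<union> range RuleK \<union> range RuleT"
| "rules cICKS4 = base_rules \<union> range RuleT \<union> range RuleS4"
| "rules cICKS5 = base_rules \<union> range RuleT \<union> range RuleS5 \<union> range RuleKImp \<union> {Cut}"

fun frames_of :: "calculus \<Rightarrow> ('w, 'a) frame set" where
  "frames_of cICK = {F. epistemic_frame F}"
| "frames_of cICKT = {F. reflexive_frame F}"
| "frames_of cICKS4 = {F. S4_frame F}"
| "frames_of cICKS5 = {F. S5_frame F}"

section \<open>Cyclic proofs\<close>

datatype ('a, 'p) tree = Node (label: "('a, 'p) sequent") (children: "('a, 'p) tree list")

text \<open>Nodes are addressed by lists of child indices, so that \<open>v\<close> is a descendant of \<open>u\<close>
  iff \<open>prefix u v\<close>.\<close>

fun is_node :: "('a, 'p) tree \<Rightarrow> nat list \<Rightarrow> bool" where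
  "is_node t [] \<longleftrightarrow> True"
| "is_node t (i # p) \<longleftrightarrow> i < length (children t) \<and> is_node (children t ! i) p"

fun subtree :: "('a, 'p) tree \<Rightarrow> nat list \<Rightarrow> ('a, 'p) tree" where
  "subtree t [] = t"
| "subtree t (i # p) = subtree (children t ! i) p"

definition label_at :: "('a, 'p) tree \<Rightarrow> nat list \<Rightarrow> ('a, 'p) sequent" where
  "label_at t p = label (subtree t p)"

definition premises_at :: "('a, 'p) tree \<Rightarrow> nat list \<Rightarrow> ('a, 'p) sequent list" where
  "premises_at t p = map label (children (subtree t p))"

definition is_leaf :: "('a, 'p) tree \<Rightarrow> nat list \<Rightarrow> bool" where
  "is_leaf t p \<longleftrightarrow> is_node t p \<and> children (subtree t p) = []"

definition pre_proof :: "calculus \<Rightarrow> ('a, 'p) tree \<Rightarrow> ('a, 'p) sequent \<Rightarrow> bool" where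
  "pre_proof P t \<sigma> \<longleftrightarrow>
     label t = \<sigma> \<and>
     (\<forall>p. is_node t p \<longrightarrow> is_sequent (label_at t p)) \<and>
     (\<forall>p. is_node t p \<longrightarrow> \<not> is_leaf t p \<longrightarrow>
        (\<exists>r\<in>rules P. rule_inst r (premises_at t p) (label_at t p)))"

text \<open>The path from \<open>u\<close> down to \<open>v\<close> consists of the \<open>p\<close> with \<open>prefix u p\<close> and \<open>prefix p v\<close>. It
  passes through the rule instance at \<open>p\<close> if it contains \<open>p\<close> and a child of \<open>p\<close>, that is, if
  moreover \<open>p \<noteq> v\<close>.\<close>

definition successful_path :: "('a, 'p) tree \<Rightarrow> nat list \<Rightarrow> nat list \<Rightarrow> bool" where
  "successful_path t u v \<longleftrightarrow>
     (\<forall>p. prefix u p \<longrightarrow> prefix p v \<longrightarrow> has_focus (label_at t p)) \<and>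
     (\<exists>p. prefix u p \<and> strict_prefix p v \<and>
        rule_inst (RuleCR Foc) (premises_at t p) (label_at t p))"

definition repetition :: "('a, 'p) tree \<Rightarrow> nat list \<Rightarrow> nat list \<Rightarrow> bool" where
  "repetition t u v \<longleftrightarrow>
     is_node t u \<and> is_node t v \<and> strict_prefix u v \<and> label_at t u = label_at t v"

definition successful_repetition :: "('a, 'p) tree \<Rightarrow> nat list \<Rightarrow> nat list \<Rightarrow> bool" where
  "successful_repetition t u v \<longleftrightarrow> repetition t u v \<and> successful_path t u v"

definition cyclic_proof :: "calculus \<Rightarrow> ('a, 'p) tree \<Rightarrow> ('a, 'p) sequent \<Rightarrow> bool" where
  "cyclic_proof P t \<sigma> \<longleftrightarrow>
     pre_proof P t \<sigma> \<and>
     (\<forall>l. is_leaf t l \<longrightarrow>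
        rule_inst AxId [] (label_at t l) \<or> rule_inst AxBot [] (label_at t l) \<or>
        (\<exists>c. successful_repetition t c l))"

end

theory Submission
  imports Defs
begin

text \<open>A sequent refuted at a world \<open>w\<close> is the conclusion of a rule instance one of whose
  premises is again refuted at some world. Attach to a refutation a number \<open>n\<close> such that the focused
  formula, \<open>C \<psi>\<close> or \<open>K\<^sub>a C \<psi>\<close>, is falsified by a world failing \<open>\<psi>\<close> that is
  reached in at most \<open>n\<close> steps, not counting the initial \<open>K\<^sub>a\<close>-step. As long as the focus is kept,
  \<open>n\<close> does not increase from conclusion to premise, and it decreases when
  \<open>C \<psi>\<close> in focus is unfolded. Hence, by induction from the leaves towards the root, a
  refuted node has below it a refuted leaf whose companion lies strictly above the node:
  if the companion were the node itself, the node would be refuted with a smaller \<open>n\<close>.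
  For the root this is impossible.\<close>

section \<open>Finite conjunctions and disjunctions\<close>

lemma set_enum_list:
  assumes "finite S" shows "set (enum_list S) = S"
  unfolding enum_list_def using finite_distinct_list[OF assms] by (rule someI2_ex) blast

lemma finite_erase:
  assumes "finite \<Gamma>" shows "finite (erase \<Gamma>)"
proof -
  have "erase \<Gamma> = fst ` \<Gamma>" by (force simp: erase_def)
  then show ?thesis using assms by simp
qed

lemma sat_conj_list: "sat F V w (conj_list \<phi>s) \<longleftrightarrow> (\<forall>\<phi>\<in>set \<phi>s. sat F V w \<phi>)"
  by (induction \<phi>s rule: conj_list.induct) auto

lemma sat_disj_list: "sat F V w (disj_list \<phi>s) \<longleftrightarrow> (\<exists>\<phi>\<in>set \<phi>s. sat F V w \<phi>)"
  by (induction \<phi>s rule: disj_list.induct) auto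

section \<open>Frame properties and persistence\<close>

lemma le_refl:
  assumes "epistemic_frame F" "w \<in> worlds F" shows "(w, w) \<in> le F"
  using assms by (simp add: epistemic_frame_def partial_order_on_def preorder_on_def refl_on_def)

lemma le_trans_frame:
  assumes "epistemic_frame F" "(u, v) \<in> le F" "(v, w) \<in> le F" shows "(u, w) \<in> le F"
  using assms by (meson epistemic_frame_def partial_order_on_def preorder_on_def transD)

lemma le_worlds:
  assumes "epistemic_frame F" "(u, v) \<in> le F" shows "u \<in> worlds F" "v \<in> worlds F"
  using assms by (auto simp: epistemic_frame_def partial_order_on_def preorder_on_def refl_on_def)

lemma acc_worlds:
  assumes "epistemic_frame F" "(u, v) \<in> acc F a" shows "u \<in> worlds F" "v \<in> worlds F"
  using assms by (auto simp: epistemic_frame_def)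

lemma triangle_confluence:
  assumes "epistemic_frame F" "(w, v) \<in> le F" "(v, u) \<in> acc F a" shows "(w, u) \<in> acc F a"
  using assms by (auto simp: epistemic_frame_def)

lemma frames_of_epistemic: "F \<in> frames_of P \<Longrightarrow> epistemic_frame F"
  by (cases P) (auto simp: reflexive_frame_def S4_frame_def S5_frame_def)

text \<open>Triangle confluence makes every \<open>acc F a\<close>-successor of \<open>v\<close> a
  successor of \<open>w\<close>. This settles \<open>K\<close> directly and, for \<open>C\<close>,
  every nonempty path; the empty path is left to the induction hypothesis.\<close>

lemma sat_persistent:
  assumes F: "epistemic_frame F" and V: "monotone_valuation F V"
  shows "(w, v) \<in> le F \<Longrightarrow> sat F V w \<phi> \<Longrightarrow> sat F V v \<phi>"
proof (induction \<phi> arbitrary: w v)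
  case (Atom p)
  then show ?case using V by (auto simp: monotone_valuation_def)
next
  case (Imp \<phi> \<psi>)
  then show ?case using le_trans_frame[OF F Imp.prems(1)] by auto
next
  case (K a \<phi>)
  then show ?case using triangle_confluence[OF F K.prems(1)] by auto
next
  case (C \<phi>)
  have "sat F V u \<phi>" if "(v, u) \<in> acc_star F" for u
    using that[unfolded acc_star_def]
  proof (cases rule: converse_rtranclE)
    case base
    have "sat F V w \<phi>" using C.prems by (simp add: acc_star_def)
    then show ?thesis using C.IH C.prems(1) base by blast
  next
    case (step y)
    then have "(w, y) \<in> (\<Union>a. acc F a)" using triangle_confluence[OF F C.prems(1)] by auto
    then have "(w, u) \<in> acc_star F"
      using step(2) by (simp add: acc_star_def converse_rtrancl_into_rtrancl)
    then show ?thesis using C.prems by simp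
  qed
  then show ?case by simp
qed auto

section \<open>Bounded distance to a failure of common knowledge\<close>

definition C_fails_within ::
  "('w, 'a) frame \<Rightarrow> ('w \<Rightarrow> 'p set) \<Rightarrow> nat \<Rightarrow> 'w \<Rightarrow> ('a, 'p) fm \<Rightarrow> bool" where
  "C_fails_within F V n w \<psi> \<longleftrightarrow> (\<exists>k\<le>n. \<exists>v. (w, v) \<in> (\<Union>a. acc F a) ^^ k \<and> \<not> sat F V v \<psi>)"

text \<open>Only meaningful for formulae that can be in focus.\<close>

definition fails_within ::
  "('w, 'a) frame \<Rightarrow> ('w \<Rightarrow> 'p set) \<Rightarrow> nat \<Rightarrow> 'w \<Rightarrow> ('a, 'p) fm \<Rightarrow> bool" where
  "fails_within F V n w \<phi> \<longleftrightarrow>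
     (\<forall>\<psi>. \<phi> = C \<psi> \<longrightarrow> C_fails_within F V n w \<psi>) \<and>
     (\<forall>a \<psi>. \<phi> = K a (C \<psi>) \<longrightarrow> (\<exists>v. (w, v) \<in> acc F a \<and> C_fails_within F V n v \<psi>))"

text \<open>\<open>acc_star\<close> is the union of the finite powers of the one-step relation, so a
  failure of \<open>C \<psi>\<close> always comes with a finite distance, which serves as the
  bound.\<close>

lemma not_sat_C_iff: "\<not> sat F V w (C \<psi>) \<longleftrightarrow> (\<exists>n. C_fails_within F V n w \<psi>)"
proof
  assume "\<not> sat F V w (C \<psi>)"
  then obtain v where "(w, v) \<in> acc_star F" "\<not> sat F V v \<psi>" by auto
  then show "\<exists>n. C_fails_within F V n w \<psi>"
    by (auto simp: C_fails_within_def acc_star_def rtrancl_power)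
next
  assume "\<exists>n. C_fails_within F V n w \<psi>"
  then show "\<not> sat F V w (C \<psi>)"
    by (auto simp: C_fails_within_def acc_star_def rtrancl_power)
qed

text \<open>For \<open>K a (C \<psi>)\<close> the bound is taken at a successor refuting
  \<open>C \<psi>\<close>; formulae that cannot be in focus satisfy \<open>fails_within\<close>
  vacuously.\<close>

lemma not_sat_fails_within:
  assumes "\<not> sat F V w \<phi>" shows "\<exists>n. fails_within F V n w \<phi>"
proof (cases "\<exists>\<psi>. \<phi> = C \<psi>")
  case True
  then show ?thesis using assms not_sat_C_iff by (fastforce simp: fails_within_def)
next
  case False
  show ?thesis
  proof (cases "\<exists>a \<psi>. \<phi> = K a (C \<psi>)")
    case True
    then obtain a \<psi> where eq: "\<phi> = K a (C \<psi>)" by blast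
    then obtain v where "(w, v) \<in> acc F a" "\<not> sat F V v (C \<psi>)" using assms by auto
    then show ?thesis using eq not_sat_C_iff[of F V v \<psi>] by (auto simp: fails_within_def)
  qed (use False in \<open>auto simp: fails_within_def\<close>)
qed

text \<open>The alternatives mirror the premises of CR: the failure is at \<open>w\<close> itself,
  matching the premise with \<open>\<psi>\<close>, or lies beyond a first \<open>a\<close>-step,
  matching the one with \<open>K a (C \<psi>)\<close>; that step lowers the bound by one.\<close>

lemma C_fails_within_cases:
  assumes "C_fails_within F V n w \<psi>"
  obtains "\<not> sat F V w \<psi>"
  | m a v where "n = Suc m" "(w, v) \<in> acc F a" "C_fails_within F V m v \<psi>"
proof -
  obtain k v where k: "k \<le> n" "(w, v) \<in> (\<Union>a. acc F a) ^^ k" "\<not> sat F V v \<psi>"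
    using assms by (auto simp: C_fails_within_def)
  show thesis
  proof (cases k)
    case 0
    then show thesis using that(1) k by simp
  next
    case (Suc j)
    then obtain u where "(w, u) \<in> (\<Union>a. acc F a)" and uv: "(u, v) \<in> (\<Union>a. acc F a) ^^ j"
      using k(2) relpow_Suc_D2[of w v j] by blast
    then obtain a where wu: "(w, u) \<in> acc F a" by blast
    obtain m where m: "n = Suc m" "j \<le> m" using k(1) Suc by (cases n) auto
    have "C_fails_within F V m u \<psi>"
      unfolding C_fails_within_def using m(2) uv k(3) by blast
    then show thesis by (rule that(2)[OF m(1) wu])
  qed
qed

section \<open>Refuted sequents\<close>

definition refuted_at ::
  "('w, 'a) frame \<Rightarrow> ('w \<Rightarrow> 'p set) \<Rightarrow> 'w \<Rightarrow> ('a, 'p) sequent \<Rightarrow> bool" where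
  "refuted_at F V w \<sigma> \<longleftrightarrow> w \<in> worlds F \<and>
     (\<forall>(\<phi>, x)\<in>ante \<sigma>. sat F V w \<phi>) \<and> (\<forall>(\<phi>, x)\<in>succd \<sigma>. \<not> sat F V w \<phi>)"

text \<open>The number \<open>n\<close> constrains only a focused formula; for a sequent without
  focus it is arbitrary.\<close>

definition refuted_within ::
  "('w, 'a) frame \<Rightarrow> ('w \<Rightarrow> 'p set) \<Rightarrow> nat \<Rightarrow> 'w \<Rightarrow> ('a, 'p) sequent \<Rightarrow> bool" where
  "refuted_within F V n w \<sigma> \<longleftrightarrow>
     refuted_at F V w \<sigma> \<and> (\<forall>\<phi>. (\<phi>, Foc) \<in> succd \<sigma> \<longrightarrow> fails_within F V n w \<phi>)"

text \<open>\<open>sequent_fm\<close> is an intuitionistic implication, so the refuting world is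
  some \<open>v\<close> above \<open>w\<close>, not necessarily \<open>w\<close>.\<close>

lemma not_sat_sequent_fm:
  assumes "epistemic_frame F" "is_sequent \<sigma>" "\<not> sat F V w (sequent_fm \<sigma>)"
  shows "\<exists>v. refuted_at F V v \<sigma>"
proof -
  have *: "set (enum_list (erase (ante \<sigma>))) = erase (ante \<sigma>)"
    "set (enum_list (erase (succd \<sigma>))) = erase (succd \<sigma>)"
    using assms(2) by (auto simp: is_sequent_def intro!: set_enum_list finite_erase)
  obtain v where "(w, v) \<in> le F" "\<forall>\<phi>\<in>erase (ante \<sigma>). sat F V v \<phi>"
    "\<forall>\<phi>\<in>erase (succd \<sigma>). \<not> sat F V v \<phi>"
    using assms(3) by (auto simp: sequent_fm_def sat_conj_list sat_disj_list *)
  then have "refuted_at F V v \<sigma>"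
    using le_worlds(2)[OF assms(1), of w v] by (auto simp: refuted_at_def erase_def)
  then show ?thesis by blast
qed

text \<open>A sequent has at most one focused formula, so the bound found for it serves the whole
  succedent.\<close>

lemma refuted_within_exists:
  assumes "is_sequent \<sigma>" "refuted_at F V w \<sigma>"
  shows "\<exists>n. refuted_within F V n w \<sigma>"
proof (cases "has_focus \<sigma>")
  case True
  then obtain \<phi> where \<phi>: "(\<phi>, Foc) \<in> succd \<sigma>" by (auto simp: has_focus_def)
  then have "\<not> sat F V w \<phi>" using assms(2) by (auto simp: refuted_at_def)
  then obtain n where "fails_within F V n w \<phi>" using not_sat_fails_within[of F V w \<phi>] by auto
  moreover have "\<psi> = \<phi>" if "(\<psi>, Foc) \<in> succd \<sigma>" for \<psi>
    using assms(1) \<phi> that unfolding is_sequent_def by blast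
  ultimately show ?thesis using assms(2) by (auto simp: refuted_within_def)
qed (use assms in \<open>auto simp: refuted_within_def has_focus_def\<close>)

section \<open>Soundness of the single rules, with bounds\<close>

definition refutation_descends ::
  "('w, 'a) frame \<Rightarrow> ('w \<Rightarrow> 'p set) \<Rightarrow> nat \<Rightarrow> 'a rule_name \<Rightarrow>
   ('a, 'p) sequent list \<Rightarrow> ('a, 'p) sequent \<Rightarrow> bool" where
  "refutation_descends F V n r \<rho>s \<sigma> \<longleftrightarrow>
     (\<exists>\<rho>\<in>set \<rho>s. \<exists>v m. refuted_within F V m v \<rho> \<and>
        (has_focus \<sigma> \<longrightarrow> has_focus \<rho> \<longrightarrow> m \<le> n \<and> (r = RuleCR Foc \<longrightarrow> m < n)))"

text \<open>For every rule other than CR with focused principal formula. If the conclusion has a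
  focus, \<open>n\<close> itself is kept; otherwise the premise may take any bound that
  \<open>refuted_within_exists\<close> supplies.\<close>

lemma refutation_descendsI:
  assumes "\<rho> \<in> set \<rho>s" "is_sequent \<rho>" "refuted_at F V v \<rho>" "r \<noteq> RuleCR Foc"
    and "\<And>\<phi>. has_focus \<sigma> \<Longrightarrow> (\<phi>, Foc) \<in> succd \<rho> \<Longrightarrow> fails_within F V n v \<phi>"
  shows "refutation_descends F V n r \<rho>s \<sigma>"
proof (cases "has_focus \<sigma>")
  case True
  then have "refuted_within F V n v \<rho>" using assms by (auto simp: refuted_within_def)
  then show ?thesis using assms(1,4) by (auto simp: refutation_descends_def)
next
  case False
  then show ?thesis
    using refuted_within_exists[OF assms(2,3)] assms(1) by (auto simp: refutation_descends_def)
qed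

text \<open>With \<open>x = Foc\<close> the bound has to drop if the focus is kept. It does, because
  unfolding turns the first step towards the failing world into the initial \<open>K a\<close>-step,
  which is not counted.\<close>

lemma refutation_descends_CR:
  assumes seq: "is_sequent (\<Gamma> \<turnstile> insert (C \<phi>, x) \<Delta>)"
    and prem: "is_sequent (\<Gamma> \<turnstile> insert (\<phi>, Unf) \<Delta>)"
      "\<And>a. is_sequent (\<Gamma> \<turnstile> insert (K a (C \<phi>), x) \<Delta>)"
    and ref: "refuted_within F V n w (\<Gamma> \<turnstile> insert (C \<phi>, x) \<Delta>)"
    and as: "set as = UNIV"
  shows "refutation_descends F V n (RuleCR x)
    ((\<Gamma> \<turnstile> insert (\<phi>, Unf) \<Delta>) # map (\<lambda>a. \<Gamma> \<turnstile> insert (K a (C \<phi>), x) \<Delta>) as)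
    (\<Gamma> \<turnstile> insert (C \<phi>, x) \<Delta>)"
    (is "refutation_descends _ _ _ _ ?\<rho>s _")
proof (cases x)
  case Unf
  \<comment> \<open>Here \<open>k\<close> only selects the premise. The world stays
    \<open>w\<close>, so a focused formula in \<open>\<Delta>\<close>, if there is one, keeps the
    bound \<open>n\<close>.\<close>
  have "\<not> sat F V w (C \<phi>)" using ref by (auto simp: refuted_within_def refuted_at_def)
  then obtain k where "C_fails_within F V k w \<phi>" using not_sat_C_iff[of F V w \<phi>] by auto
  then show ?thesis
  proof (cases rule: C_fails_within_cases)
    case 1
    then show ?thesis
      using ref prem(1) Unf
      by (intro refutation_descendsI[where \<rho> = "\<Gamma> \<turnstile> insert (\<phi>, Unf) \<Delta>" and v = w])
        (auto simp: refuted_within_def refuted_at_def)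
  next
    case (2 m a v)
    then have "\<not> sat F V w (K a (C \<phi>))" using not_sat_C_iff by fastforce
    then show ?thesis
      using ref prem(2) Unf as
      by (intro refutation_descendsI[where \<rho> = "\<Gamma> \<turnstile> insert (K a (C \<phi>), x) \<Delta>" and v = w])
        (auto simp: refuted_within_def refuted_at_def)
  qed
next
  case Foc
  \<comment> \<open>As contexts may repeat displayed formulae, \<open>\<Delta>\<close> could a
    priori contain a focused one. Uniqueness of the focus would make it equal to
    \<open>C \<phi>\<close> in the conclusion and to \<open>K a (C \<phi>)\<close> in a premise;
    \<open>undefined\<close> merely names some agent.\<close>
  have unfocused: "(\<chi>, Foc) \<notin> \<Delta>" for \<chi>
  proof
    assume "(\<chi>, Foc) \<in> \<Delta>"
    then have "\<chi> = C \<phi>" "\<chi> = K (undefined :: 'a) (C \<phi>)"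
      using seq prem(2) Foc unfolding is_sequent_def by fastforce+
    then show False by simp
  qed
  have "C_fails_within F V n w \<phi>"
    using ref Foc by (auto simp: refuted_within_def fails_within_def)
  then show ?thesis
  proof (cases rule: C_fails_within_cases)
    case 1
    \<comment> \<open>This premise has lost the focus, so no decrease is demanded.\<close>
    then have "refuted_within F V n w (\<Gamma> \<turnstile> insert (\<phi>, Unf) \<Delta>)"
      using ref unfocused by (auto simp: refuted_within_def refuted_at_def)
    then show ?thesis
      using unfocused by (force simp: refutation_descends_def has_focus_def)
  next
    case (2 m a v)
    then have "\<not> sat F V w (K a (C \<phi>))" using not_sat_C_iff by fastforce
    \<comment> \<open>The step to \<open>v\<close> becomes the uncounted one, which leaves
      \<open>m\<close>, and \<open>n = Suc m\<close>.\<close>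
    then have "refuted_within F V m w (\<Gamma> \<turnstile> insert (K a (C \<phi>), x) \<Delta>)"
      using ref unfocused 2 by (auto simp: refuted_within_def refuted_at_def fails_within_def)
    moreover have "(\<Gamma> \<turnstile> insert (K a (C \<phi>), x) \<Delta>) \<in> set ?\<rho>s" using as by auto
    ultimately show ?thesis
      unfolding refutation_descends_def using 2(1)
      by (intro bexI[of _ "\<Gamma> \<turnstile> insert (K a (C \<phi>), x) \<Delta>"] exI[of _ w] exI[of _ m]) simp_all
  qed
qed

text \<open>If \<open>K a \<phi>\<close> is in focus, the successor must be the one that starts a
  shortest path to a failing world.\<close>

lemma refuting_successor:
  assumes seq: "is_sequent (\<Gamma> \<turnstile> insert (K a \<phi>, x) \<Delta>)"
    and ref: "refuted_within F V n w (\<Gamma> \<turnstile> insert (K a \<phi>, x) \<Delta>)"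
  shows "\<exists>v. (w, v) \<in> acc F a \<and> \<not> sat F V v \<phi> \<and> (x = Foc \<longrightarrow> fails_within F V n v \<phi>)"
proof (cases x)
  case Unf
  then show ?thesis using ref by (auto simp: refuted_within_def refuted_at_def)
next
  case Foc
  then obtain \<psi> where \<psi>: "\<phi> = C \<psi>" using seq unfolding is_sequent_def by auto
  moreover have "fails_within F V n w (K a \<phi>)" using ref Foc by (auto simp: refuted_within_def)
  ultimately obtain v where "(w, v) \<in> acc F a" "C_fails_within F V n v \<psi>"
    by (auto simp: fails_within_def)
  then show ?thesis using \<psi> not_sat_C_iff[of F V v \<psi>] by (auto simp: fails_within_def)
qed

text \<open>For S5: formulae \<open>K a \<chi>\<close> thus have the same truth value at related
  worlds, and the bounds for \<open>K a (C \<psi>)\<close> transfer as well.\<close>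

lemma sat_K_equiv:
  assumes "equiv (worlds F) (acc F a)" "(w, v) \<in> acc F a"
  shows "(w, u) \<in> acc F a \<longleftrightarrow> (v, u) \<in> acc F a"
  using assms by (meson equivE symD transD)

text \<open>The refutation stays at \<open>w\<close>, except that \<open>ImpR\<close> moves up along
  \<open>le\<close> and \<open>RuleK\<close>, \<open>RuleS4\<close> and \<open>RuleS5\<close> move
  to a successor. The frame conditions come from the calculi \<open>P\<close> that contain the
  rule.\<close>

lemma refutation_descends:
  assumes r: "r \<in> rules P" "rule_inst r \<rho>s \<sigma>" and F: "F \<in> frames_of P"
    and V: "monotone_valuation F V" and seq: "is_sequent \<sigma>" "\<And>\<rho>. \<rho> \<in> set \<rho>s \<Longrightarrow> is_sequent \<rho>"
    and ref: "refuted_within F V n w \<sigma>"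
  shows "refutation_descends F V n r \<rho>s \<sigma>"
proof -
  have ep: "epistemic_frame F" using F by (rule frames_of_epistemic)
  have w: "w \<in> worlds F" using ref by (simp add: refuted_within_def refuted_at_def)
  have ww: "(w, w) \<in> le F" by (rule le_refl[OF ep w])
  have L: "sat F V w \<chi>" if "(\<chi>, y) \<in> ante \<sigma>" for \<chi> y
    using ref that by (auto simp: refuted_within_def refuted_at_def)
  have R: "\<not> sat F V w \<chi>" if "(\<chi>, y) \<in> succd \<sigma>" for \<chi> y
    using ref that by (auto simp: refuted_within_def refuted_at_def)
  show ?thesis
    using r(2)
  proof cases
    case (1 \<phi> \<Gamma> x \<Delta>)
    then show ?thesis using ref by (auto simp: refuted_within_def refuted_at_def)
  next
    case (2 \<Gamma> \<Delta>)
    then show ?thesis using ref by (auto simp: refuted_within_def refuted_at_def)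
  next
    case (3 \<phi> \<psi> \<Gamma> \<Delta>)
    then show ?thesis using ref seq
      by (intro refutation_descendsI[where \<rho> = "\<rho>s ! 0" and v = w])
        (auto simp: refuted_within_def refuted_at_def)
  next
    case (4 \<Gamma> \<phi> \<Delta> \<psi>)
    then have "\<not> sat F V w \<phi> \<or> \<not> sat F V w \<psi>"
      using ref by (auto simp: refuted_within_def refuted_at_def)
    then show ?thesis
    proof
      assume "\<not> sat F V w \<phi>"
      then show ?thesis using ref seq 4
        by (intro refutation_descendsI[where \<rho> = "\<rho>s ! 0" and v = w])
          (auto simp: refuted_within_def refuted_at_def)
    next
      assume "\<not> sat F V w \<psi>"
      then show ?thesis using ref seq 4
        by (intro refutation_descendsI[where \<rho> = "\<rho>s ! 1" and v = w])
          (auto simp: refuted_within_def refuted_at_def)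
    qed
  next
    case (5 \<phi> \<Gamma> \<Delta> \<psi>)
    then have "sat F V w \<phi> \<or> sat F V w \<psi>"
      using ref by (auto simp: refuted_within_def refuted_at_def)
    then show ?thesis
    proof
      assume "sat F V w \<phi>"
      then show ?thesis using ref seq 5
        by (intro refutation_descendsI[where \<rho> = "\<rho>s ! 0" and v = w])
          (auto simp: refuted_within_def refuted_at_def)
    next
      assume "sat F V w \<psi>"
      then show ?thesis using ref seq 5
        by (intro refutation_descendsI[where \<rho> = "\<rho>s ! 1" and v = w])
          (auto simp: refuted_within_def refuted_at_def)
    qed
  next
    case (6 \<Gamma> \<phi> \<psi> \<Delta>)
    then show ?thesis using ref seq
      by (intro refutation_descendsI[where \<rho> = "\<rho>s ! 0" and v = w])
        (auto simp: refuted_within_def refuted_at_def)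
  next
    case (7 \<Gamma> \<phi> \<Delta> \<psi>)
    show ?thesis
    proof (cases "sat F V w \<phi>")
      case False
      then show ?thesis using ref seq 7
        by (intro refutation_descendsI[where \<rho> = "\<rho>s ! 0" and v = w])
          (auto simp: refuted_within_def refuted_at_def)
    next
      case True
      then have "sat F V w \<psi>"
        using ref ww 7 by (auto simp: refuted_within_def refuted_at_def)
      then show ?thesis using ref seq 7
        by (intro refutation_descendsI[where \<rho> = "\<rho>s ! 1" and v = w])
          (auto simp: refuted_within_def refuted_at_def)
    qed
  next
    case (8 \<phi> \<Gamma> \<psi> \<Delta>)
    then obtain v where v: "(w, v) \<in> le F" "sat F V v \<phi>" "\<not> sat F V v \<psi>"
      using ref by (auto simp: refuted_within_def refuted_at_def)
    \<comment> \<open>Persistence carries the antecedent to \<open>v\<close>; the premise has no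
      focus, so there is no bound to preserve.\<close>
    then have "sat F V v \<chi>" if "sat F V w \<chi>" for \<chi>
      using sat_persistent[OF ep V] that by blast
    moreover have "v \<in> worlds F" using le_worlds[OF ep v(1)] by blast
    ultimately show ?thesis using ref seq 8 v
      by (intro refutation_descendsI[where \<rho> = "\<rho>s ! 0" and v = v])
        (auto simp: refuted_within_def refuted_at_def)
  next
    case (9 \<Gamma> \<phi> \<Delta>)
    then show ?thesis using ref seq
      by (intro refutation_descendsI[where \<rho> = "\<rho>s ! 0" and v = w])
        (auto simp: refuted_within_def refuted_at_def)
  next
    case (10 \<Gamma> \<phi> \<Delta>)
    \<comment> \<open>If the conclusion already has a focus, it lies in \<open>\<Delta>\<close>. As
      the premise is a sequent, that focus must coincide with \<open>\<phi>\<close>, which inherits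
      its bound.\<close>
    have "fails_within F V n w \<chi>"
      if foc: "has_focus \<sigma>" and \<chi>: "(\<chi>, Foc) \<in> insert (\<phi>, Foc) \<Delta>" for \<chi>
    proof -
      obtain \<psi> where \<psi>: "(\<psi>, Foc) \<in> \<Delta>" using foc 10 by (auto simp: has_focus_def)
      then have "\<chi> = \<psi>"
        using seq(2)[of "\<Gamma> \<turnstile> insert (\<phi>, Foc) \<Delta>"] \<chi> 10 by (auto simp: is_sequent_def)
      then show ?thesis using \<psi> ref 10 by (simp add: refuted_within_def)
    qed
    then show ?thesis using ref seq 10
      by (intro refutation_descendsI[where \<rho> = "\<rho>s ! 0" and v = w])
        (auto simp: refuted_within_def refuted_at_def)
  next
    case (11 a \<Gamma> \<phi> x \<Pi> \<Sigma>)
    obtain v where v: "(w, v) \<in> acc F a" "\<not> sat F V v \<phi>" "x = Foc \<longrightarrow> fails_within F V n v \<phi>"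
      using refuting_successor[OF seq(1)[unfolded 11] ref[unfolded 11]] by auto
    have "sat F V v \<chi>" if "(\<chi>, y) \<in> \<Gamma>" for \<chi> y
    proof -
      have "(K a \<chi>, y) \<in> ante \<sigma>" using that 11 by (simp add: K_set_def)
      then have "sat F V w (K a \<chi>)" by (rule L)
      then show ?thesis using v(1) by simp
    qed
    then show ?thesis using v acc_worlds[OF ep v(1)] seq(2) 11
      by (intro refutation_descendsI[where \<rho> = "\<rho>s ! 0" and v = v]) (auto simp: refuted_at_def)
  next
    case (12 a \<phi> \<Gamma> \<Delta>)
    have "(w, w) \<in> acc F a"
      using F r(1) w 12
      by (cases P) (auto simp: reflexive_frame_def S4_frame_def S5_frame_def base_rules_def
          equiv_def refl_on_def)
    then show ?thesis using ref seq 12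
      by (intro refutation_descendsI[where \<rho> = "\<rho>s ! 0" and v = w])
        (auto simp: refuted_within_def refuted_at_def)
  next
    case (13 a \<Gamma> \<phi> x \<Pi> \<Sigma>)
    have tr: "trans (acc F a)"
      using F r(1) 13 by (cases P) (auto simp: S4_frame_def base_rules_def)
    obtain v where v: "(w, v) \<in> acc F a" "\<not> sat F V v \<phi>" "x = Foc \<longrightarrow> fails_within F V n v \<phi>"
      using refuting_successor[OF seq(1)[unfolded 13] ref[unfolded 13]] by auto
    have "sat F V v \<chi>" if \<chi>: "(\<chi>, y) \<in> K_set a \<Gamma>" for \<chi> y
    proof -
      have "sat F V w \<chi>" using L[of \<chi> y] \<chi> 13 by simp
      moreover obtain \<psi> where "\<chi> = K a \<psi>" using \<chi> by (auto simp: K_set_def)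
      ultimately show ?thesis using transD[OF tr v(1)] by simp
    qed
    then show ?thesis using v acc_worlds[OF ep v(1)] seq(2) 13
      by (intro refutation_descendsI[where \<rho> = "\<rho>s ! 0" and v = v]) (auto simp: refuted_at_def)
  next
    case (14 a \<Gamma> \<phi> x \<Delta> \<Pi> \<Sigma>)
    have eq: "equiv (worlds F) (acc F a)"
      using F r(1) 14 by (cases P) (auto simp: S5_frame_def base_rules_def)
    obtain v where v: "(w, v) \<in> acc F a" "\<not> sat F V v \<phi>" "x = Foc \<longrightarrow> fails_within F V n v \<phi>"
      using refuting_successor[OF seq(1)[unfolded 14] ref[unfolded 14]] by auto
    note same = sat_K_equiv[OF eq v(1)]
    have left: "sat F V v \<chi>" if \<chi>: "(\<chi>, y) \<in> K_set a \<Gamma>" for \<chi> y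
    proof -
      have "sat F V w \<chi>" using L[of \<chi> y] \<chi> 14 by simp
      moreover obtain \<psi> where "\<chi> = K a \<psi>" using \<chi> by (auto simp: K_set_def)
      ultimately show ?thesis using same by simp
    qed
    have right: "\<not> sat F V v \<chi>" if \<chi>: "(\<chi>, y) \<in> K_set a \<Delta>" for \<chi> y
    proof -
      have "\<not> sat F V w \<chi>" using R[of \<chi> y] \<chi> 14 by simp
      moreover obtain \<psi> where "\<chi> = K a \<psi>" using \<chi> by (auto simp: K_set_def)
      ultimately show ?thesis using same by simp
    qed
    \<comment> \<open>The focus may sit in the boxed side context. Its bound survives the move
      because \<open>w\<close> and \<open>v\<close> have the same
      \<open>a\<close>-successors.\<close>
    have "fails_within F V n v \<chi>" if \<chi>: "(\<chi>, Foc) \<in> K_set a \<Delta>" for \<chi>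
    proof -
      have "fails_within F V n w \<chi>" using ref 14 \<chi> by (simp add: refuted_within_def)
      moreover obtain \<psi> where "\<chi> = K a \<psi>" using \<chi> by (auto simp: K_set_def)
      ultimately show ?thesis using same by (simp add: fails_within_def)
    qed
    then show ?thesis using v left right acc_worlds[OF ep v(1)] seq(2) 14
      by (intro refutation_descendsI[where \<rho> = "\<rho>s ! 0" and v = v]) (auto simp: refuted_at_def)
  next
    case (15 a \<phi> \<Gamma> \<psi> \<Delta>)
    have eq: "equiv (worlds F) (acc F a)"
      using F r(1) 15 by (cases P) (auto simp: S5_frame_def base_rules_def)
    obtain v where v: "(w, v) \<in> le F" "sat F V v (K a \<phi>)" "\<not> sat F V v \<psi>"
      using ref 15 by (auto simp: refuted_within_def refuted_at_def)
    have "\<not> sat F V w \<psi>" using sat_persistent[OF ep V v(1)] v(3) by blast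
    \<comment> \<open>Reflexivity and triangle confluence place \<open>le F\<close> inside
      \<open>acc F a\<close>, so \<open>K a \<phi>\<close> passes back from \<open>v\<close> to
      \<open>w\<close>. Staying at \<open>w\<close> keeps \<open>\<Delta>\<close> refuted.\<close>
    moreover have "(v, v) \<in> acc F a" using eq le_worlds[OF ep v(1)] by (auto simp: equiv_def refl_on_def)
    then have "(w, v) \<in> acc F a" using triangle_confluence[OF ep v(1)] by blast
    then have "sat F V w (K a \<phi>)" using v(2) sat_K_equiv[OF eq, of w v] by simp
    ultimately show ?thesis using ref seq 15
      by (intro refutation_descendsI[where \<rho> = "\<rho>s ! 0" and v = w])
        (auto simp: refuted_within_def refuted_at_def)
  next
    case (16 \<phi> \<Gamma> \<Delta>)
    then have "sat F V w (C \<phi>)" using ref by (auto simp: refuted_within_def refuted_at_def)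
    then have "sat F V w \<phi>" by (simp add: acc_star_def)
    moreover have "sat F V w (K a (C \<phi>))" for a
      using \<open>sat F V w (C \<phi>)\<close> converse_rtrancl_into_rtrancl[of w _ "\<Union>a. acc F a"]
      unfolding acc_star_def sat.simps by blast
    ultimately show ?thesis using ref seq 16
      by (intro refutation_descendsI[where \<rho> = "\<rho>s ! 0" and v = w])
        (auto simp: refuted_within_def refuted_at_def)
  next
    case (17 as x \<Gamma> \<phi> \<Delta>)
    show ?thesis unfolding 17(1-3)
      by (rule refutation_descends_CR) (use seq ref 17 in auto)
  next
    case (18 \<phi> \<Gamma> \<Delta>)
    show ?thesis
    proof (cases "sat F V w \<phi>")
      case True
      then show ?thesis using ref seq 18
        by (intro refutation_descendsI[where \<rho> = "\<rho>s ! 0" and v = w])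
          (auto simp: refuted_within_def refuted_at_def)
    next
      case False
      then show ?thesis using ref seq 18
        by (intro refutation_descendsI[where \<rho> = "\<rho>s ! 1" and v = w])
          (auto simp: refuted_within_def refuted_at_def)
    qed
  qed
qed

lemma RuleCR_in_rules: "RuleCR x \<in> rules P"
  by (cases P) (auto simp: base_rules_def)

section \<open>Addresses in proof trees\<close>

lemma is_node_append: "is_node t (p @ q) \<longleftrightarrow> is_node t p \<and> is_node (subtree t p) q"
  by (induction t p rule: is_node.induct) auto

lemma subtree_append: "subtree t (p @ q) = subtree (subtree t p) q"
  by (induction t p rule: subtree.induct) auto

lemma size_child:
  assumes "s \<in> set (children t)" shows "size s < size t"
  using assms by (cases t) (auto dest: size_list_estimation'[of _ _ "size s" size] simp: less_Suc_eq_le)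

lemma child_in_children:
  assumes "is_node t u" "s \<in> set (children (subtree t u))"
  obtains i where "is_node t (u @ [i])" "subtree t (u @ [i]) = s"
  using assms by (auto simp: in_set_conv_nth is_node_append subtree_append)

section \<open>Refutations along branches and back to companions\<close>

definition CR_focused_at :: "('a, 'p) tree \<Rightarrow> nat list \<Rightarrow> bool" where
  "CR_focused_at t p \<longleftrightarrow> rule_inst (RuleCR Foc) (premises_at t p) (label_at t p)"

lemma refuted_child:
  assumes pp: "pre_proof P t \<sigma>" and F: "F \<in> frames_of P" and V: "monotone_valuation F V"
    and u: "is_node t u" "\<not> is_leaf t u" and ref: "refuted_within F V n w (label_at t u)"
  obtains i v m where "is_node t (u @ [i])" "refuted_within F V m v (label_at t (u @ [i]))"
    "has_focus (label_at t u) \<Longrightarrow> has_focus (label_at t (u @ [i])) \<Longrightarrow>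
       m \<le> n \<and> (CR_focused_at t u \<longrightarrow> m < n)"
proof -
  \<comment> \<open>A node may instantiate several rules; the focused CR is preferred, as it
    is the only one that makes the bound drop.\<close>
  obtain r where r: "r \<in> rules P" "rule_inst r (premises_at t u) (label_at t u)"
    "CR_focused_at t u \<Longrightarrow> r = RuleCR Foc"
    using pp u RuleCR_in_rules unfolding pre_proof_def CR_focused_at_def by metis
  have seq: "is_sequent (label_at t p)" if "is_node t p" for p
    using pp that by (simp add: pre_proof_def)
  have "is_sequent \<rho>" if \<rho>: "\<rho> \<in> set (premises_at t u)" for \<rho>
  proof -
    obtain s where s: "s \<in> set (children (subtree t u))" "\<rho> = label s"
      using \<rho> by (auto simp: premises_at_def)
    show ?thesis using child_in_children[OF u(1) s(1)] seq s(2) by (metis label_at_def)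
  qed
  then have "refutation_descends F V n r (premises_at t u) (label_at t u)"
    using refutation_descends[OF r(1,2) F V seq[OF u(1)] _ ref] by blast
  then obtain s v m where s: "s \<in> set (children (subtree t u))"
    and m: "refuted_within F V m v (label s)"
      "has_focus (label_at t u) \<Longrightarrow> has_focus (label s) \<Longrightarrow> m \<le> n \<and> (r = RuleCR Foc \<longrightarrow> m < n)"
    by (auto simp: refutation_descends_def premises_at_def)
  obtain i where i: "is_node t (u @ [i])" "subtree t (u @ [i]) = s"
    using child_in_children[OF u(1) s] .
  then have "label_at t (u @ [i]) = label s" by (simp add: label_at_def)
  then show ?thesis using that[OF i(1), of m v] m r(3) by auto
qed

lemma axiom_not_refuted:
  assumes "rule_inst AxId [] \<sigma> \<or> rule_inst AxBot [] \<sigma>"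
  shows "\<not> refuted_within F V n w \<sigma>"
  using assms by (auto simp: refuted_within_def refuted_at_def elim: rule_inst.cases)

text \<open>The invariant of the induction. It also records a strict drop of the bound between
  \<open>u\<close> and \<open>l\<close>, needed later at the companion \<open>c\<close>, when only
  the part of the path below \<open>c\<close> has been traversed.\<close>

definition escapes ::
  "('w, 'a) frame \<Rightarrow> ('w \<Rightarrow> 'p set) \<Rightarrow> ('a, 'p) tree \<Rightarrow> nat list \<Rightarrow> nat \<Rightarrow> bool" where
  "escapes F V t u n \<longleftrightarrow>
     (\<exists>c l w m. successful_repetition t c l \<and> strict_prefix c u \<and> prefix u l \<and>
        refuted_within F V m w (label_at t l) \<and> m \<le> n \<and>
        ((\<exists>p. prefix u p \<and> strict_prefix p l \<and> CR_focused_at t p) \<longrightarrow> m < n))"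

text \<open>The outer induction climbs from the leaves by subtree size. The inner one, on
  \<open>n\<close> at a fixed node, handles leaves whose companion is that very node.\<close>

lemma refuted_node_escapes:
  assumes cyc: "cyclic_proof P t \<sigma>" and F: "F \<in> frames_of P" and V: "monotone_valuation F V"
  shows "is_node t u \<Longrightarrow> refuted_within F V n w (label_at t u) \<Longrightarrow> escapes F V t u n"
proof (induction "size (subtree t u)" arbitrary: u n w rule: less_induct)
  case less
  have pp: "pre_proof P t \<sigma>" using cyc by (simp add: cyclic_proof_def)
  show ?case
    using less.prems
  proof (induction n arbitrary: w rule: less_induct)
    case bound: (less n)
    show ?case
    proof (cases "is_leaf t u")
      case True
      \<comment> \<open>A refuted leaf is no axiom, so it has a companion. Take \<open>l = u\<close>
        and \<open>m = n\<close>: no rule instance lies between \<open>u\<close> and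
        \<open>l\<close>.\<close>
      then obtain c where "successful_repetition t c u"
        using cyc bound.prems(2) axiom_not_refuted unfolding cyclic_proof_def by metis
      then show ?thesis
        using bound.prems(2) unfolding escapes_def
        by (intro exI[of _ c] exI[of _ u] exI[of _ w] exI[of _ n])
          (auto simp: successful_repetition_def repetition_def)
    next
      case False
      obtain i v k where i: "is_node t (u @ [i])"
        and k: "refuted_within F V k v (label_at t (u @ [i]))"
          "has_focus (label_at t u) \<Longrightarrow> has_focus (label_at t (u @ [i])) \<Longrightarrow>
             k \<le> n \<and> (CR_focused_at t u \<longrightarrow> k < n)"
        using refuted_child[OF pp F V bound.prems(1) False bound.prems(2)] by blast
      have "size (subtree t (u @ [i])) < size (subtree t u)"
        using i by (auto simp: is_node_append subtree_append intro!: size_child)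
      then obtain c l x m where rep: "successful_repetition t c l"
        and c: "strict_prefix c (u @ [i])" and l: "prefix (u @ [i]) l"
        and m: "refuted_within F V m x (label_at t l)" "m \<le> k"
          "(\<exists>p. prefix (u @ [i]) p \<and> strict_prefix p l \<and> CR_focused_at t p) \<Longrightarrow> m < k"
        using less.hyps[OF _ i k(1)] unfolding escapes_def by blast
      have cu: "prefix c u" using c by (auto simp: strict_prefix_def)
      have ul: "prefix u l" using l by (meson append_prefixD)
      \<comment> \<open>Since \<open>c\<close> is at or above \<open>u\<close>, both
        \<open>u\<close> and its child lie on the successful path from \<open>c\<close> to
        \<open>l\<close>, so their bounds are comparable.\<close>
      have "has_focus (label_at t u)" "has_focus (label_at t (u @ [i]))"
        using rep cu ul l prefix_order.trans[of c u "u @ [i]"]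
        by (auto simp: successful_repetition_def successful_path_def)
      then have kn: "k \<le> n" "CR_focused_at t u \<Longrightarrow> k < n" using k(2) by auto
      \<comment> \<open>A focused CR at \<open>u\<close> gives \<open>k < n\<close>; one further
        down gives \<open>m < k\<close>.\<close>
      have drop: "m < n" if p: "prefix u p" "strict_prefix p l" "CR_focused_at t p" for p
      proof (cases "p = u")
        case True
        then show ?thesis using p kn m(2) by simp
      next
        case False
        obtain q r where "p = u @ q" "l = u @ i # r" using p(1) l by (auto simp: prefix_def)
        with False p(2) have "prefix (u @ [i]) p"
          by (cases q) (auto simp: strict_prefix_def)
        then show ?thesis using p m(3) kn(1) by (meson less_le_trans)
      qed
      show ?thesis
      proof (cases "c = u")
        case True
        \<comment> \<open>The path from \<open>u\<close> to \<open>l\<close> contains a focused CR.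
          As both nodes carry the same sequent, \<open>u\<close> itself is refuted within
          \<open>m\<close>, and the inner hypothesis applies.\<close>
        then have "m < n" "label_at t l = label_at t u"
          using rep drop
          by (auto simp: successful_repetition_def successful_path_def repetition_def
              CR_focused_at_def)
        then have "escapes F V t u m" using bound.IH[of m] m(1) bound.prems(1) by simp
        then show ?thesis using \<open>m < n\<close> unfolding escapes_def by (meson le_less_trans less_imp_le)
      next
        case False
        then have "strict_prefix c u" using cu by (simp add: strict_prefix_def)
        then show ?thesis
          using rep ul m(1,2) kn(1) drop unfolding escapes_def by (meson le_trans)
      qed
    qed
  qed
qed

theorem mainTheorem12:
  fixes P :: calculus
    and \<sigma> :: "('a::finite, 'p) sequent"
  assumes "is_sequent \<sigma>"
    and "\<exists>t. cyclic_proof P t \<sigma>"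
  shows "valid_sequent_over (frames_of P :: ('w, 'a) frame set) \<sigma>"
  unfolding valid_sequent_over_def valid_over_def
proof (intro ballI allI impI, rule ccontr)
  fix F :: "('w, 'a) frame" and V :: "'w \<Rightarrow> 'p set" and w
  assume F: "F \<in> frames_of P" and V: "monotone_valuation F V"
    and "\<not> sat F V w (sequent_fm \<sigma>)"
  then obtain v where "refuted_at F V v \<sigma>"
    using not_sat_sequent_fm[OF frames_of_epistemic[OF F] assms(1), of V w] by auto
  then obtain n where n: "refuted_within F V n v \<sigma>"
    using refuted_within_exists[OF assms(1), of F V v] by auto
  obtain t where t: "cyclic_proof P t \<sigma>" using assms(2) by blast
  then have "label_at t [] = \<sigma>" by (simp add: cyclic_proof_def pre_proof_def label_at_def)
  then have "escapes F V t [] n" using refuted_node_escapes[OF t F V, of "[]"] n by simp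
  \<comment> \<open>The root address \<open>[]\<close> has no strict prefix to serve as
    companion.\<close>
  then show False by (simp add: escapes_def)
qed

end
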